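(* Let $q\geq 2$ and $n\geq 2$ be integers and let $C$ be an extended $1$-perfect code in the Hamming graph $H(n,q)$. Then $$(q-2)\,\frac{(q-1)^x-(-1)^x}{x}\in\mathbb{N},\qquad\text{where } x=\frac{n+q-2}{q}.$$
   Context: The Hamming graph $H(n,q)$ has as vertices all words of length $n$ over the alphabet $\{0,1,\dots,q-1\}$, two words being adjacent iff they differ in exactly one coordinate; the Hamming distance is the number of differing coordinates. A code is a subset of the vertex set. A code $C$ in a graph $G$ is $1$-perfect if the vertex set of $G$ is partitioned by the balls of radius $1$ centered at the vertices of $C$. A code $C$ in $H(n,q)$ is an extended $1$-perfect code if deleting (puncturing) any single coordinate position from all codewords yields a $1$-perfect code in $H(n-1,q)$. *)

theory Defs
  imports Complex_Main "HOL-Library.Disjoint_Sets"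
begin

type_synonym word = "nat list"

definition words :: "nat \<Rightarrow> nat \<Rightarrow> word set" where
  "words n q = {w. length w = n \<and> set w \<subseteq> {..<q}}"

text \<open>Only meaningful for words of equal length.\<close>

definition hamming_dist :: "word \<Rightarrow> word \<Rightarrow> nat" where
  "hamming_dist u v = card {i. i < length u \<and> u ! i \<noteq> v ! i}"

text \<open>A graph is given by its vertex set and its symmetric, irreflexive adjacency relation.\<close>

type_synonym 'a graph = "'a set \<times> ('a \<times> 'a) set"

definition hamming_graph :: "nat \<Rightarrow> nat \<Rightarrow> word graph" where
  "hamming_graph n q =
     (words n q, {(u, v). u \<in> words n q \<and> v \<in> words n q \<and> hamming_dist u v = 1})"

text \<open>Balls are taken in the path metric: a vertex lies in the ball of radius \<open>r\<close> iff some walk of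
  length at most \<open>r\<close> leads to it from the centre.\<close>

definition graph_ball :: "'a graph \<Rightarrow> nat \<Rightarrow> 'a \<Rightarrow> 'a set" where
  "graph_ball G r c = {v \<in> fst G. \<exists>k\<le>r. (c, v) \<in> snd G ^^ k}"

text \<open>The balls form a partition as a family indexed by the codewords. The set of all balls would
  not do: in a complete graph all balls of radius 1 coincide, and every nonempty
  code would be perfect.\<close>

definition one_perfect :: "'a graph \<Rightarrow> 'a set \<Rightarrow> bool" where
  "one_perfect G C \<longleftrightarrow>
     C \<subseteq> fst G \<and>
     disjoint_family_on (graph_ball G 1) C \<and>
     (\<Union>c\<in>C. graph_ball G 1 c) = fst G"

definition puncture :: "nat \<Rightarrow> word \<Rightarrow> word" where
  "puncture i w = take i w @ drop (Suc i) w"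

definition extended_one_perfect :: "nat \<Rightarrow> nat \<Rightarrow> word set \<Rightarrow> bool" where
  "extended_one_perfect n q C \<longleftrightarrow>
     C \<subseteq> fst (hamming_graph n q) \<and>
     (\<forall>i<n. one_perfect (hamming_graph (n - 1) q) (puncture i ` C))"

end

(* Let a be the difference of the distance enumerators A_u(t) = sum over c in C of t^d(u,c), for a
   word u at distance 1 and a word v at distance 2 from C. Summing the enumerators of all n
   punctured codes gives e = n a + (1 - t) a', and perfectness of the punctured codes yields
     (1 + (q-1)(n-1) t) e + (1 - t)(1 + (q-1) t) e' = 0,  e(0) = 1.
   Comparing orders at t = 1 shows that r = (1 + (q-1)(n-1)) / q is the order of e there, so that
   x = n - r is a natural number. Solving both equations gives
     q x a = (1 + (q-1) t)^x (1 - t)^(n-x) - (1 - t)^n,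
   and, since a has integer coefficients, the coefficient of t^n shows that q x divides
   (q-1)^x - (-1)^x. *)

theory Submission
  imports Defs "HOL-Computational_Algebra.Polynomial"
begin

section \<open>Hamming distance\<close>

lemma finite_words [simp]: "finite (words n q)"
proof -
  have "words n q = {w. set w \<subseteq> {..<q} \<and> length w = n}" by (auto simp: words_def)
  then show ?thesis using finite_lists_length_eq[of "{..<q}" n] by simp
qed

lemma words_nth_less: "w \<in> words n q \<Longrightarrow> i < n \<Longrightarrow> w ! i < q"
  using nth_mem by (fastforce simp: words_def)

lemma words_update: "w \<in> words n q \<Longrightarrow> a < q \<Longrightarrow> w[i := a] \<in> words n q"
  using set_update_subset_insert[of w i a] by (auto simp: words_def)

lemma words_Suc: "words (Suc m) q = (\<lambda>(a, w). a # w) ` ({..<q} \<times> words m q)"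
  by (auto simp: words_def length_Suc_conv image_iff) 

lemma hamming_dist_Nil [simp]: "hamming_dist [] v = 0"
  by (simp add: hamming_dist_def)

lemma hamming_dist_Cons [simp]:
  "hamming_dist (a # u) (b # v) = of_bool (a \<noteq> b) + hamming_dist u v"
proof -
  have "{i. i < length (a # u) \<and> (a # u) ! i \<noteq> (b # v) ! i} =
      {i. i = 0 \<and> a \<noteq> b} \<union> Suc ` {i. i < length u \<and> u ! i \<noteq> v ! i}"
    by (auto simp: image_iff less_Suc_eq_0_disj)
  moreover have "card \<dots> = card {i::nat. i = 0 \<and> a \<noteq> b} + hamming_dist u v"
    unfolding hamming_dist_def by (subst card_Un_disjoint) (auto simp: card_image)
  ultimately show ?thesis by (simp add: hamming_dist_def)
qed

lemma hamming_dist_append: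
  "length u = length u' \<Longrightarrow>
     hamming_dist (u @ v) (u' @ v') = hamming_dist u u' + hamming_dist v v'"
  by (induction u u' rule: list_induct2) auto

lemma hamming_dist_puncture:
  assumes "length u = length v" "i < length u"
  shows "hamming_dist u v = hamming_dist (puncture i u) (puncture i v) + of_bool (u ! i \<noteq> v ! i)"
proof -
  have u: "u = take i u @ u ! i # drop (Suc i) u" and v: "v = take i v @ v ! i # drop (Suc i) v"
    using assms by (auto simp: id_take_nth_drop)
  have "hamming_dist u v = hamming_dist (take i u @ u ! i # drop (Suc i) u)
      (take i v @ v ! i # drop (Suc i) v)"
    using u v by simp
  also have "\<dots> = hamming_dist (puncture i u) (puncture i v) + of_bool (u ! i \<noteq> v ! i)"
    using assms by (simp add: hamming_dist_append puncture_def)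
  finally show ?thesis .
qed

lemma puncture_update: "i < length v \<Longrightarrow> puncture i (v[i := a]) = puncture i v"
  by (simp add: puncture_def)

lemma puncture_words: "w \<in> words n q \<Longrightarrow> i < n \<Longrightarrow> puncture i w \<in> words (n - 1) q"
  using set_take_subset[of i w] set_drop_subset[of "Suc i" w]
  by (auto simp: words_def puncture_def)

text \<open>Both words have the same puncturing at \<open>i\<close>, so only that coordinate
  matters. Putting a term on each side avoids truncated subtraction.\<close>

lemma hamming_dist_update:
  assumes "length u = length v" "i < length u"
  shows "hamming_dist u (v[i := a]) + of_bool (u ! i \<noteq> v ! i) =
         hamming_dist u v + of_bool (u ! i \<noteq> a)"
  using hamming_dist_puncture[of u v i] hamming_dist_puncture[of u "v[i := a]" i] assms
  by (simp add: puncture_update)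

lemma hamming_dist_commute:
  assumes "length u = length v"
  shows "hamming_dist u v = hamming_dist v u"
  using assms by (simp add: hamming_dist_def eq_commute)

lemma hamming_dist_self [simp]: "hamming_dist u u = 0"
  by (simp add: hamming_dist_def)

lemma hamming_dist_eq_0_iff:
  assumes "length u = length v"
  shows "hamming_dist u v = 0 \<longleftrightarrow> u = v"
  using assms by (induction u v rule: list_induct2) auto

lemma hamming_dist_triangle:
  assumes "length u = length v" "length v = length w"
  shows "hamming_dist u w \<le> hamming_dist u v + hamming_dist v w"
  using assms by (induction u v w rule: list_induct3) auto

lemma sum_of_bool_neq_nth:
  "(\<Sum>i<length u. of_bool (u ! i \<noteq> v ! i)) = hamming_dist u v"
proof -
  have "{..<length u} \<inter> {i. u ! i \<noteq> v ! i} = {i. i < length u \<and> u ! i \<noteq> v ! i}" by auto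
  then show ?thesis by (simp add: hamming_dist_def)
qed

section \<open>Balls of radius 1 in the Hamming graph\<close>

lemma graph_ball_1:
  assumes "p \<in> words m q"
  shows "graph_ball (hamming_graph m q) 1 p = {w \<in> words m q. hamming_dist p w \<le> 1}"
proof -
  have "(\<exists>k\<le>1. (p, w) \<in> snd (hamming_graph m q) ^^ k) \<longleftrightarrow> hamming_dist p w \<le> 1"
    if "w \<in> words m q" for w
  proof -
    have "length p = length w" using that assms by (simp add: words_def)
    have "(\<exists>k\<le>1. (p, w) \<in> snd (hamming_graph m q) ^^ k) \<longleftrightarrow>
        p = w \<or> (p, w) \<in> snd (hamming_graph m q)"
      by (auto simp: le_Suc_eq)
    also have "\<dots> \<longleftrightarrow> hamming_dist p w \<le> 1"
      using that assms hamming_dist_eq_0_iff[OF \<open>length p = length w\<close>]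
      by (auto simp: hamming_graph_def le_Suc_eq)
    finally show ?thesis .
  qed
  then show ?thesis unfolding graph_ball_def by (auto simp: hamming_graph_def)
qed

text \<open>Parametrises the ball without its centre by the changed position and the new letter, so
  that a sum over the ball becomes a double sum.\<close>

lemma graph_ball_1_update:
  assumes "p \<in> words m q"
  shows "bij_betw (\<lambda>(k, a). p[k := a]) (SIGMA k:{..<m}. {..<q} - {p ! k})
           (graph_ball (hamming_graph m q) 1 p - {p})"
proof -
  have [simp]: "length p = m" using assms by (simp add: words_def)
  have inj: "inj_on (\<lambda>(k, a). p[k := a]) (SIGMA k:{..<m}. {..<q} - {p ! k})"
  proof (rule inj_onI)
    fix y z
    assume y: "y \<in> (SIGMA k:{..<m}. {..<q} - {p ! k})"
      and z: "z \<in> (SIGMA k:{..<m}. {..<q} - {p ! k})"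
      and eq: "(case y of (k, a) \<Rightarrow> p[k := a]) = (case z of (k, a) \<Rightarrow> p[k := a])"
    obtain k a l b where yz: "y = (k, a)" "z = (l, b)" by (cases y, cases z)
    \<comment> \<open>For \<open>l \<noteq> k\<close> the right side would be \<open>p ! k\<close>,
      which \<open>a\<close> must avoid.\<close>
    have *: "p[k := a] ! k = p[l := b] ! k" using eq yz by simp
    then have "k = l" using y z yz by (auto simp: nth_list_update split: if_splits)
    then show "y = z" using * y yz by simp
  qed
  have d: "hamming_dist p (p[k := a]) = of_bool (p ! k \<noteq> a)" if "k < m" for k a
    using hamming_dist_update[of p p k a] that by simp
  have "w \<in> (\<lambda>(k, a). p[k := a]) ` (SIGMA k:{..<m}. {..<q} - {p ! k})"
    if w: "w \<in> words m q" "hamming_dist p w \<le> 1" "w \<noteq> p" for w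
  proof -
    have lw: "length w = m" using w by (simp add: words_def)
    then obtain k where k: "k < m" "p ! k \<noteq> w ! k"
      using \<open>w \<noteq> p\<close> by (metis \<open>length p = m\<close> nth_equalityI)
    then have "hamming_dist (puncture k p) (puncture k w) = 0"
      using hamming_dist_puncture[of p w k] w lw by simp
    then have "hamming_dist (p[k := w ! k]) w = 0"
      using hamming_dist_puncture[of "p[k := w ! k]" w k] k lw by (simp add: puncture_update)
    then have "w = p[k := w ! k]" using hamming_dist_eq_0_iff[of "p[k := w ! k]" w] lw by simp
    then show ?thesis using k words_nth_less[OF w(1)] by (auto intro!: image_eqI[of _ _ "(k, w ! k)"])
  qed
  moreover have "p[k := a] \<noteq> p" if "k < m" "a \<noteq> p ! k" for k a
    using that by (metis \<open>length p = m\<close> nth_list_update_eq)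
  ultimately show ?thesis
    unfolding bij_betw_def graph_ball_1[OF assms] using inj assms
    by (auto simp: d words_update)
qed

section \<open>Distance enumerators\<close>

lemma pderiv_sum: "pderiv (\<Sum>x\<in>A. f x) = (\<Sum>x\<in>A. pderiv (f x))"
  by (induction A rule: infinite_finite_induct) (auto simp: pderiv_add)

definition distance_enum :: "word set \<Rightarrow> word \<Rightarrow> real poly" where
  "distance_enum P u = (\<Sum>p\<in>P. monom 1 (hamming_dist u p))"

text \<open>The enumerator factors over the coordinates: in each one, a single letter agrees with
  \<open>u\<close> and the other \<open>q - 1\<close> contribute \<open>t\<close> each.\<close>

lemma distance_enum_words:
  assumes "u \<in> words m q"
  shows "distance_enum (words m q) u = [:1, real q - 1:] ^ m"
  using assms
proof (induction m arbitrary: u)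
  case 0
  have "words 0 q = {[]}" by (auto simp: words_def)
  then show ?case using 0 by (simp add: distance_enum_def monom_0 flip: one_pCons)
next
  case (Suc m)
  then obtain b v where u: "u = b # v" and b: "b < q" and v: "v \<in> words m q"
    by (auto simp: words_Suc)
  have inj: "inj_on (\<lambda>(a, w). a # w) ({..<q} \<times> words m q)" by (auto simp: inj_on_def)
  have "(\<Sum>a<q. monom 1 (of_bool (b \<noteq> a))) = (monom 1 0 :: real poly) + (\<Sum>a\<in>{..<q}-{b}. monom 1 1)"
    using b by (subst sum.remove[of _ b]) auto
  also have "\<dots> = [:1, real q - 1:]"
    \<comment> \<open>Real polynomials are equal iff their values are, which turns the claim into an
      identity of real numbers.\<close>
    using b by (simp add: poly_eq_poly_eq_iff[symmetric] fun_eq_iff poly_monom of_nat_diff)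
  finally have *: "(\<Sum>a<q. monom 1 (of_bool (b \<noteq> a))) = [:1, real q - 1:]" .
  have "distance_enum (words (Suc m) q) u =
      (\<Sum>a<q. \<Sum>w\<in>words m q. monom 1 (of_bool (b \<noteq> a)) * monom 1 (hamming_dist v w))"
    unfolding distance_enum_def words_Suc sum.reindex[OF inj]
    by (simp add: u case_prod_unfold sum.cartesian_product mult_monom)
  also have "\<dots> = (\<Sum>a<q. monom 1 (of_bool (b \<noteq> a))) * distance_enum (words m q) v"
    by (simp add: distance_enum_def sum_product)
  finally show ?case using Suc.IH[OF v] * by simp
qed

text \<open>With \<open>d = hamming_dist u p\<close>, the ball has its centre at distance
  \<open>d\<close> from \<open>u\<close>, and further \<open>d\<close> words at
  \<open>d - 1\<close>, \<open>d * (q - 2)\<close> at \<open>d\<close> and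
  \<open>(m - d) * (q - 1)\<close> at \<open>d + 1\<close>. Since \<open>d\<close> enters linearly,
  it can be absorbed into a derivative.\<close>

lemma distance_enum_ball:
  assumes p: "p \<in> words m q" and u: "u \<in> words m q"
  shows "distance_enum (graph_ball (hamming_graph m q) 1 p) u =
    [:1, (real q - 1) * real m:] * monom 1 (hamming_dist u p) +
    [:1, -1:] * [:1, real q - 1:] * pderiv (monom 1 (hamming_dist u p))"
proof -
  define d where "d = hamming_dist u p"
  define G where "G = graph_ball (hamming_graph m q) 1 p"
  have [simp]: "length p = m" "length u = m" using p u by (auto simp: words_def)
  have G: "finite G" "p \<in> G" using p by (simp_all add: G_def graph_ball_1 del: One_nat_def)
  \<comment> \<open>Encoding the two cases by \<open>of_bool\<close> makes the sum over
    \<open>k\<close> depend only on the number of disagreements. Where they disagree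
    \<open>d \<ge> 1\<close>, so \<open>d - 1\<close> is not truncated.\<close>
  have row: "(\<Sum>a\<in>{..<q}-{p ! k}. monom 1 (hamming_dist u (p[k := a]))) =
      of_bool (u ! k \<noteq> p ! k) * (monom 1 (d - 1) + monom (real q - 2) d - monom (real q - 1) (Suc d)) +
      monom (real q - 1) (Suc d)"
    if k: "k < m" for k
  proof (cases "u ! k = p ! k")
    case True
    have "(\<Sum>a\<in>{..<q}-{p ! k}. monom 1 (hamming_dist u (p[k := a]))) =
        (\<Sum>a\<in>{..<q}-{p ! k}. monom (1::real) (Suc d))"
      using hamming_dist_update[of u p k] k True
      by (intro sum.cong) (auto simp: d_def)
    then show ?thesis
      using True words_nth_less[OF p k]
      by (simp add: poly_eq_poly_eq_iff[symmetric] fun_eq_iff poly_monom of_nat_diff)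
  next
    case False
    have uk: "u ! k \<in> {..<q} - {p ! k}" using False words_nth_less[OF u k] by auto
    have "(\<Sum>a\<in>{..<q}-{p ! k}. monom 1 (hamming_dist u (p[k := a]))) =
        monom (1::real) (hamming_dist u (p[k := u ! k])) +
        (\<Sum>a\<in>{..<q}-{p ! k}-{u ! k}. monom 1 (hamming_dist u (p[k := a])))"
      using uk by (subst sum.remove[of _ "u ! k"]) auto
    also have "(\<Sum>a\<in>{..<q}-{p ! k}-{u ! k}. monom 1 (hamming_dist u (p[k := a]))) =
        (\<Sum>a\<in>{..<q}-{p ! k}-{u ! k}. monom (1::real) d)"
    proof (intro sum.cong refl)
      fix a assume "a \<in> {..<q}-{p ! k}-{u ! k}"
      then have "hamming_dist u (p[k := a]) = d"
        using hamming_dist_update[of u p k a] k False by (auto simp: d_def)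
      then show "monom 1 (hamming_dist u (p[k := a])) = monom (1::real) d" by simp
    qed
    also have "hamming_dist u (p[k := u ! k]) = d - 1"
      using hamming_dist_update[of u p k "u ! k"] k False by (simp add: d_def)
    also have "card ({..<q}-{p ! k}-{u ! k}) = q - 2"
      using uk words_nth_less[OF p k] by simp
    \<comment> \<open>The letters \<open>u ! k\<close> and \<open>p ! k\<close> are distinct, so
      \<open>q - 2\<close> may be cast to the reals.\<close>
    moreover have "q \<ge> 2" using uk words_nth_less[OF p k] by (cases q) auto
    ultimately show ?thesis
      using False
      by (simp add: poly_eq_poly_eq_iff[symmetric] fun_eq_iff poly_monom of_nat_diff)
  qed
  have "distance_enum G u = monom 1 d + (\<Sum>w\<in>G - {p}. monom 1 (hamming_dist u w))"
    unfolding distance_enum_def using G by (simp add: sum.remove[of _ p] d_def)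
  also have "(\<Sum>w\<in>G - {p}. monom (1::real) (hamming_dist u w)) =
      (\<Sum>k<m. \<Sum>a\<in>{..<q}-{p ! k}. monom 1 (hamming_dist u (p[k := a])))"
    unfolding G_def sum.reindex_bij_betw[OF graph_ball_1_update[OF p], symmetric]
    by (subst sum.Sigma) (auto simp: case_prod_unfold)
  also have "\<dots> = of_nat (\<Sum>k<m. of_bool (u ! k \<noteq> p ! k)) *
        (monom 1 (d - 1) + monom (real q - 2) d - monom (real q - 1) (Suc d)) +
      of_nat m * monom (real q - 1) (Suc d)"
    by (simp add: row sum.distrib flip: sum_distrib_right)
  also have "(\<Sum>k<m. of_bool (u ! k \<noteq> p ! k)) = d"
    using sum_of_bool_neq_nth[of u p] by (simp add: d_def)
  finally have "distance_enum G u = monom 1 d + (of_nat d *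
        (monom 1 (d - 1) + monom (real q - 2) d - monom (real q - 1) (Suc d)) +
      of_nat m * monom (real q - 1) (Suc d))" .
  \<comment> \<open>For \<open>d = 0\<close> the truncated exponent \<open>d - 1\<close> is harmless
    because of the factor \<open>of_nat d\<close>.\<close>
  also have "\<dots> = [:1, (real q - 1) * real m:] * monom 1 d +
    [:1, -1:] * [:1, real q - 1:] * pderiv (monom 1 d)"
    by (cases d)
      (auto simp: poly_eq_poly_eq_iff[symmetric] fun_eq_iff poly_monom pderiv_monom algebra_simps)
  finally show ?thesis by (simp add: G_def d_def)
qed

text \<open>The balls partition the whole space, and the operator in
  \<open>distance_enum_ball\<close> is linear, so summing over the centres yields the enumerator of
  all words.\<close>

lemma distance_enum_one_perfect:
  assumes P: "one_perfect (hamming_graph m q) P" and u: "u \<in> words m q"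
  shows "[:1, (real q - 1) * real m:] * distance_enum P u +
    [:1, -1:] * [:1, real q - 1:] * pderiv (distance_enum P u) = [:1, real q - 1:] ^ m"
proof -
  have sub: "P \<subseteq> words m q" and disj: "disjoint_family_on (graph_ball (hamming_graph m q) 1) P"
    and cover: "(\<Union>c\<in>P. graph_ball (hamming_graph m q) 1 c) = words m q"
    using P by (auto simp: one_perfect_def hamming_graph_def)
  have fin: "finite P" using finite_subset[OF sub] by simp
  have "[:1, real q - 1:] ^ m = distance_enum (\<Union>c\<in>P. graph_ball (hamming_graph m q) 1 c) u"
    using distance_enum_words[OF u] cover by simp
  also have "\<dots> = (\<Sum>c\<in>P. distance_enum (graph_ball (hamming_graph m q) 1 c) u)"
    unfolding distance_enum_def using disj fin sub
    by (intro sum.UNION_disjoint)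
      (auto simp: disjoint_family_on_def graph_ball_1 subset_iff simp del: One_nat_def)
  also have "\<dots> = (\<Sum>c\<in>P. [:1, (real q - 1) * real m:] * monom 1 (hamming_dist u c) +
    [:1, -1:] * [:1, real q - 1:] * pderiv (monom 1 (hamming_dist u c)))"
    using sub u by (intro sum.cong refl distance_enum_ball) auto
  also have "\<dots> = [:1, (real q - 1) * real m:] * distance_enum P u +
    [:1, -1:] * [:1, real q - 1:] * pderiv (distance_enum P u)"
    unfolding distance_enum_def pderiv_sum sum_distrib_left sum.distrib ..
  finally show ?thesis ..
qed

text \<open>Coefficients are counts, hence integers; this is what finally turns a closed form into
  divisibility.\<close>

lemma coeff_distance_enum:
  "finite P \<Longrightarrow> coeff (distance_enum P u) j = real (card {p \<in> P. hamming_dist u p = j})"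
  by (simp add: distance_enum_def coeff_sum of_bool_def[symmetric] Int_def conj_commute)

section \<open>Distances between codewords\<close>

lemma one_perfect_subset: "one_perfect (hamming_graph m q) P \<Longrightarrow> P \<subseteq> words m q"
  by (simp add: one_perfect_def hamming_graph_def)

lemma one_perfect_unique:
  assumes P: "one_perfect (hamming_graph m q) P" and "p \<in> P" "p' \<in> P" "w \<in> words m q"
    and "hamming_dist p w \<le> 1" "hamming_dist p' w \<le> 1"
  shows "p = p'"
proof (rule ccontr)
  assume "p \<noteq> p'"
  then have "graph_ball (hamming_graph m q) 1 p \<inter> graph_ball (hamming_graph m q) 1 p' = {}"
    using assms by (auto simp: one_perfect_def disjoint_family_on_def)
  moreover have "p \<in> words m q" "p' \<in> words m q" using assms one_perfect_subset by blast+
  ultimately show False using assms by (auto simp: graph_ball_1 simp del: One_nat_def)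
qed

text \<open>At distance at most 2, moving \<open>p\<close> one coordinate towards \<open>p'\<close>
  would give a word in both balls.\<close>

lemma one_perfect_dist:
  assumes P: "one_perfect (hamming_graph m q) P" and pp': "p \<in> P" "p' \<in> P" "p \<noteq> p'"
  shows "hamming_dist p p' \<ge> 3"
proof (rule ccontr)
  assume "\<not> ?thesis"
  then have le2: "hamming_dist p p' \<le> 2" by simp
  have W: "p \<in> words m q" "p' \<in> words m q" using assms one_perfect_subset by blast+
  then have [simp]: "length p = m" "length p' = m" by (auto simp: words_def)
  obtain k where k: "k < m" "p ! k \<noteq> p' ! k"
    using \<open>p \<noteq> p'\<close> by (metis \<open>length p = m\<close> \<open>length p' = m\<close> nth_equalityI)
  define w where "w = p[k := p' ! k]"
  have "hamming_dist p w \<le> 1"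
    using hamming_dist_update[of p p k "p' ! k"] k by (simp add: w_def)
  moreover have "hamming_dist p' w \<le> 1"
    using hamming_dist_update[of p' p k "p' ! k"] k le2
    by (simp add: w_def hamming_dist_commute[of p' p])
  moreover have "w \<in> words m q"
    using words_update[OF W(1)] words_nth_less[OF W(2) k(1)] by (simp add: w_def)
  ultimately show False using one_perfect_unique[OF P pp'(1,2)] pp'(3) by blast
qed

text \<open>Puncturing at a coordinate where the codewords differ leaves distance at least 3, and
  that coordinate adds 1. The only obstacle is a pair with equal puncturings, which a second
  coordinate excludes.\<close>

lemma extended_one_perfect_dist:
  assumes n: "n \<ge> 2" and C: "extended_one_perfect n q C" and cc': "c \<in> C" "c' \<in> C" "c \<noteq> c'"
  shows "hamming_dist c c' \<ge> 4"
proof -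
  have "c \<in> words n q" "c' \<in> words n q"
    using C cc' by (auto simp: extended_one_perfect_def hamming_graph_def)
  then have [simp]: "length c = n" "length c' = n" by (auto simp: words_def)
  have len: "length (puncture j c) = length (puncture j c')" for j
    by (simp add: puncture_def)
  \<comment> \<open>Distance 0 has to be allowed, since injectivity of puncturing on
    \<open>C\<close> is only derived from this lemma later.\<close>
  have dist: "hamming_dist (puncture j c) (puncture j c') = 0 \<or>
      hamming_dist (puncture j c) (puncture j c') \<ge> 3" if "j < n" for j
    using one_perfect_dist[of "n - 1" q "puncture j ` C" "puncture j c" "puncture j c'"] C cc' that
    by (cases "puncture j c = puncture j c'")
      (auto simp: extended_one_perfect_def hamming_dist_eq_0_iff[OF len])
  obtain i where i: "i < n" "c ! i \<noteq> c' ! i"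
    using \<open>c \<noteq> c'\<close> by (metis \<open>length c = n\<close> \<open>length c' = n\<close> nth_equalityI)
  have di: "hamming_dist c c' = hamming_dist (puncture i c) (puncture i c') + 1"
    using hamming_dist_puncture[of c c' i] i by simp
  show ?thesis
  proof (cases "hamming_dist (puncture i c) (puncture i c') = 0")
    case False
    then show ?thesis using dist[OF i(1)] di by simp
  next
    case True
    \<comment> \<open>Then \<open>c\<close> and \<open>c'\<close> differ only at \<open>i\<close>, and puncturing elsewhere leaves them at distance 1.\<close>
    obtain j where j: "j < n" "j \<noteq> i" using n by (cases "i = 0") (auto intro: that[of 0] that[of 1])
    have "c ! j = c' ! j"
    proof (rule ccontr)
      assume "c ! j \<noteq> c' ! j"
      then have "{i, j} \<subseteq> {i. i < length c \<and> c ! i \<noteq> c' ! i}" using i j by auto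
      then have "card {i, j} \<le> hamming_dist c c'"
        unfolding hamming_dist_def by (intro card_mono) auto
      then show False using j True di by simp
    qed
    then show ?thesis
      using hamming_dist_puncture[of c c' j] j dist[OF j(1)] True di by simp
  qed
qed

section \<open>From the punctured codes to the extended code\<close>

text \<open>For a codeword at distance \<open>d\<close> from \<open>u\<close>, \<open>d\<close> of
  the puncturings lower the distance by 1 and \<open>n - d\<close> keep it, giving
  \<open>d t^(d-1) + (n - d) t^d\<close>.\<close>

lemma sum_distance_enum_puncture:
  assumes n: "n \<ge> 2" and C: "extended_one_perfect n q C" and u: "u \<in> words n q"
  shows "(\<Sum>i<n. distance_enum (puncture i ` C) (puncture i u)) =
    [:real n:] * distance_enum C u + [:1, -1:] * pderiv (distance_enum C u)"
proof -
  have CW: "C \<subseteq> words n q" using C by (simp add: extended_one_perfect_def hamming_graph_def)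
  have inj: "inj_on (puncture i) C" if "i < n" for i
  proof (rule inj_onI, rule ccontr)
    fix c c' assume cc': "c \<in> C" "c' \<in> C" "puncture i c = puncture i c'" "c \<noteq> c'"
    then have "length c = n" "length c' = n" using CW by (auto simp: words_def)
    then have "hamming_dist c c' \<le> 1" using hamming_dist_puncture[of c c' i] cc' that by simp
    then show False using extended_one_perfect_dist[OF n C, of c c'] cc' by simp
  qed
  have enum_term: "(\<Sum>i<n. monom (1::real) (hamming_dist (puncture i u) (puncture i c))) =
    [:real n:] * monom 1 (hamming_dist u c) + [:1, -1:] * pderiv (monom 1 (hamming_dist u c))"
    if "c \<in> C" for c
  proof -
    define d where "d = hamming_dist u c"
    have [simp]: "length c = n" "length u = n" using that CW u by (auto simp: words_def)
    have "(\<Sum>i<n. monom (1::real) (hamming_dist (puncture i u) (puncture i c))) =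
       (\<Sum>i<n. of_bool (u ! i \<noteq> c ! i) * (monom 1 (d - 1) - monom 1 d) + monom 1 d)"
      using hamming_dist_puncture[of u c] by (intro sum.cong) (auto simp: d_def)
    also have "\<dots> = of_nat (\<Sum>i<n. of_bool (u ! i \<noteq> c ! i)) * (monom 1 (d - 1) - monom 1 d) +
        of_nat n * monom 1 d"
      by (simp add: sum.distrib flip: sum_distrib_right)
    also have "(\<Sum>i<n. of_bool (u ! i \<noteq> c ! i)) = d"
      using sum_of_bool_neq_nth[of u c] by (simp add: d_def)
    also have "of_nat d * (monom 1 (d - 1) - monom 1 d) + of_nat n * monom 1 d =
        [:real n:] * monom 1 d + [:1, -1:] * pderiv (monom 1 d)"
      by (cases d)
        (auto simp: poly_eq_poly_eq_iff[symmetric] fun_eq_iff poly_monom pderiv_monom algebra_simps)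
    finally show ?thesis by (simp add: d_def)
  qed
  have "(\<Sum>i<n. distance_enum (puncture i ` C) (puncture i u)) =
      (\<Sum>i<n. \<Sum>c\<in>C. monom 1 (hamming_dist (puncture i u) (puncture i c)))"
    unfolding distance_enum_def using inj by (simp add: sum.reindex)
  also have "\<dots> = (\<Sum>c\<in>C. \<Sum>i<n. monom 1 (hamming_dist (puncture i u) (puncture i c)))"
    by (rule sum.swap)
  also have "\<dots> = [:real n:] * distance_enum C u + [:1, -1:] * pderiv (distance_enum C u)"
    unfolding distance_enum_def pderiv_sum sum_distrib_left sum.distrib[symmetric]
    using enum_term by (rule sum.cong[OF refl])
  finally show ?thesis .
qed

text \<open>The right side does not depend on \<open>u\<close>, so it cancels when two words are
  compared.\<close>

lemma distance_enum_extended_one_perfect: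
  assumes n: "n \<ge> 2" and C: "extended_one_perfect n q C" and u: "u \<in> words n q"
    and E: "E = [:real n:] * distance_enum C u + [:1, -1:] * pderiv (distance_enum C u)"
  shows "[:1, (real q - 1) * (real n - 1):] * E + [:1, -1:] * [:1, real q - 1:] * pderiv E =
    of_nat n * [:1, real q - 1:] ^ (n - 1)"
proof -
  let ?P = "\<lambda>i. distance_enum (puncture i ` C) (puncture i u)"
  have "[:1, (real q - 1) * (real n - 1):] * E + [:1, -1:] * [:1, real q - 1:] * pderiv E =
    (\<Sum>i<n. [:1, (real q - 1) * real (n - 1):] * ?P i + [:1, -1:] * [:1, real q - 1:] * pderiv (?P i))"
    unfolding E sum_distance_enum_puncture[OF n C u, symmetric] pderiv_sum sum_distrib_left sum.distrib
    using n by (simp add: of_nat_diff)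
  also have "\<dots> = (\<Sum>i<n. [:1, real q - 1:] ^ (n - 1))"
    using C u by (intro sum.cong distance_enum_one_perfect puncture_words refl)
      (auto simp: extended_one_perfect_def)
  finally show ?thesis by simp
qed

section \<open>The differential equation\<close>

text \<open>Uniqueness at the regular point 0: a nonzero \<open>h\<close> vanishing there has a
  derivative of order one less, so the two sides of the equation would have different orders at
  0.\<close>

lemma poly_ode_unique:
  fixes h p w :: "real poly"
  assumes eq: "p * pderiv h = w * h" and "poly p 0 \<noteq> 0" and h0: "poly h 0 = 0"
  shows "h = 0"
proof (rule ccontr)
  assume "h \<noteq> 0"
  then have ord: "order 0 h = Suc (order 0 (pderiv h))" using h0 by (rule order_pderiv)
  have "p \<noteq> 0" using assms(2) by auto
  have "pderiv h \<noteq> 0"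
  proof
    assume "pderiv h = 0"
    then obtain c where "h = [:c:]" using pderiv_iszero by blast
    then show False using h0 \<open>h \<noteq> 0\<close> by simp
  qed
  then have nz: "p * pderiv h \<noteq> 0" using \<open>p \<noteq> 0\<close> by simp
  have "order 0 (p * pderiv h) = order 0 (pderiv h)"
    using nz assms(2) by (simp add: order_mult order_0I)
  moreover have "order 0 (p * pderiv h) \<ge> order 0 h"
    using nz unfolding eq by (simp add: order_mult)
  ultimately show False using ord by simp
qed

text \<open>Multiplying by the base restores the exponent \<open>k\<close>, so \<open>k = 0\<close>
  is covered without a truncated \<open>k - 1\<close>.\<close>

lemma linear_times_pderiv_power:
  fixes c d :: real
  shows "[:c, d:] * pderiv ([:c, d:] ^ k) = smult (real k * d) ([:c, d:] ^ k)"
proof (cases k)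
  case (Suc j)
  then show ?thesis
    by (simp add: pderiv_power_Suc pderiv_pCons poly_eq_poly_eq_iff[symmetric] fun_eq_iff algebra_simps
        del: power_Suc) (simp add: algebra_simps)
qed simp

text \<open>The point 1 is singular. Writing \<open>e = (t - 1)^r g\<close> with
  \<open>g(1) \<noteq> 0\<close>, cancelling the power and evaluating at 1 leaves
  \<open>1 + (q-1)(n-1) - q r = 0\<close>.\<close>

lemma order_ode:
  fixes e :: "real poly"
  assumes q: "q \<ge> 2" and n: "n \<ge> 2" and "e \<noteq> 0"
    and ode: "[:1, (real q - 1) * (real n - 1):] * e + [:1, -1:] * [:1, real q - 1:] * pderiv e = 0"
  shows "real q * real (order 1 e) = 1 + (real q - 1) * (real n - 1)"
proof -
  define r where "r = order 1 e"
  obtain g where e: "e = [:-1, 1:] ^ r * g" and g: "\<not> [:-1, 1:] dvd g"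
    using order_decomp[OF \<open>e \<noteq> 0\<close>, of 1] by (auto simp: r_def)
  have "[:1, -1:] * pderiv e = - ([:-1, 1:] * pderiv ([:-1, 1:] ^ r)) * g -
      [:-1, 1:] ^ r * ([:-1, 1:] * pderiv g)"
    unfolding e pderiv_mult by (simp add: algebra_simps)
  also have "[:-1, 1:] * pderiv ([:-1, 1:] ^ r) = smult (real r) ([:-1, 1:] ^ r)"
    using linear_times_pderiv_power[of "-1" 1 r] by simp
  finally have D: "[:1, -1:] * pderiv e = [:-1, 1:] ^ r * (- smult (real r) g - [:-1, 1:] * pderiv g)"
    by (simp add: algebra_simps)
  have "[:1, (real q - 1) * (real n - 1):] * e + [:1, real q - 1:] * ([:1, -1:] * pderiv e) = 0"
    using ode by (simp only: mult_ac)
  then have "[:-1, 1:] ^ r * ([:1, (real q - 1) * (real n - 1):] * g +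
      [:1, real q - 1:] * (- smult (real r) g - [:-1, 1:] * pderiv g)) = 0"
    unfolding D by (subst (asm) e) (simp only: distrib_left mult_ac)
  then have "[:1, (real q - 1) * (real n - 1):] * g +
      [:1, real q - 1:] * (- smult (real r) g - [:-1, 1:] * pderiv g) = 0"
    by (simp only: mult_eq_0_iff power_eq_0_iff) auto
  then have "poly ([:1, (real q - 1) * (real n - 1):] * g +
      [:1, real q - 1:] * (- smult (real r) g - [:-1, 1:] * pderiv g)) 1 = 0"
    by simp
  then have "(1 + (real q - 1) * (real n - 1) - real q * real r) * poly g 1 = 0"
    by (simp add: algebra_simps)
  moreover have "poly g 1 \<noteq> 0" using g by (simp add: poly_eq_0_iff_dvd)
  ultimately show ?thesis by (simp add: r_def)
qed

text \<open>Explicit solutions are guessed first for \<open>e\<close> and then for \<open>a\<close>;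
  \<open>poly_ode_unique\<close> confirms each from its value at 0.\<close>

lemma distance_enum_difference:
  fixes a :: "real poly"
  assumes q: "q \<ge> 2" and n: "n \<ge> 2"
    and e: "e = [:real n:] * a + [:1, -1:] * pderiv a"
    and ode: "[:1, (real q - 1) * (real n - 1):] * e + [:1, -1:] * [:1, real q - 1:] * pderiv e = 0"
    and a0: "coeff a 0 = 0" and a1: "coeff a 1 = 1"
  obtains x r where "x \<ge> 1" "n = x + r" "real q * real x = real n + real q - 2"
    "smult (real q * real x) a = [:1, real q - 1:] ^ x * [:1, -1:] ^ r - [:1, -1:] ^ n"
proof -
  let ?S = "[:1, real q - 1:]" and ?D = "[:1, -1:] :: real poly"
  \<comment> \<open>The value is \<open>n * coeff a 0 + coeff a 1\<close>.\<close>
  have e0: "poly e 0 = 1"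
    using a0 a1 by (simp add: e poly_0_coeff_0 coeff_pderiv)
  then have "e \<noteq> 0" by auto
  define r where "r = order 1 e"
  have r: "real q * real r = 1 + (real q - 1) * (real n - 1)"
    unfolding r_def by (rule order_ode[OF q n \<open>e \<noteq> 0\<close> ode])
  also have "\<dots> \<le> real q * (real n - 1)" using n by (simp add: algebra_simps)
  finally have "real r \<le> real n - 1" using q by simp
  then have "r < n" using n by linarith
  \<comment> \<open>This is \<open>x - 1\<close>. The bound \<open>r < n\<close> just shown prevents
    truncation.\<close>
  define k where "k = n - 1 - r"
  have nk: "n = Suc k + r" using \<open>r < n\<close> by (simp add: k_def)
  have k: "real k * (real q - 1) = real r - 1" and x: "real q * real (Suc k) = real n + real q - 2"
    using r by (simp_all add: nk algebra_simps)
  have Sk: "poly ?S z * poly (pderiv (?S ^ k)) z = (real k * (real q - 1)) * poly (?S ^ k) z" for z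
    using arg_cong[OF linear_times_pderiv_power[of 1 "real q - 1" k], of "\<lambda>p. poly p z"]
    by (simp only: poly_mult poly_smult)
  have Dr: "poly ?D z * poly (pderiv (?D ^ j)) z = - real j * poly (?D ^ j) z" for z j
    using arg_cong[OF linear_times_pderiv_power[of 1 "-1" j], of "\<lambda>p. poly p z"]
    by (simp only: poly_mult poly_smult mult_minus_right mult_1_right)
  \<comment> \<open>The solution found by separating variables: the exponents are the residues at
    the two singular points.\<close>
  define f where "f = ?S ^ k * ?D ^ r"
  have f: "[:1, (real q - 1) * (real n - 1):] * f + ?D * ?S * pderiv f = 0"
  proof (rule poly_ext)
    fix z
    have "poly ([:1, (real q - 1) * (real n - 1):] * f + ?D * ?S * pderiv f) z =
       poly [:1, (real q - 1) * (real n - 1):] z * (poly (?S ^ k) z * poly (?D ^ r) z) +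
       poly ?D z * (poly ?S z * poly (pderiv (?S ^ k)) z) * poly (?D ^ r) z +
       poly ?S z * (poly ?D z * poly (pderiv (?D ^ r)) z) * poly (?S ^ k) z"
      unfolding f_def pderiv_mult poly_mult poly_add by (simp only: algebra_simps)
    also have "\<dots> = (poly [:1, (real q - 1) * (real n - 1):] z + (real k * (real q - 1)) * poly ?D z
        - real r * poly ?S z) * (poly (?S ^ k) z * poly (?D ^ r) z)"
      unfolding Sk Dr by (simp only: algebra_simps)
    \<comment> \<open>With \<open>k (q-1) = r - 1\<close> the constant term cancels, and the
      coefficient of \<open>z\<close> vanishes by the equation for \<open>r\<close>.\<close>
    also have "poly [:1, (real q - 1) * (real n - 1):] z + (real k * (real q - 1)) * poly ?D z
        - real r * poly ?S z = 0"
      using r unfolding k by (simp add: algebra_simps) (metis distrib_left mult.commute)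
    finally show "poly ([:1, (real q - 1) * (real n - 1):] * f + ?D * ?S * pderiv f) z = poly 0 z"
      by simp
  qed
  have "e - f = 0"
  proof (rule poly_ode_unique)
    show "(?D * ?S) * pderiv (e - f) = (- [:1, (real q - 1) * (real n - 1):]) * (e - f)"
    proof -
      have "[:1, (real q - 1) * (real n - 1):] * (e - f) + ?D * ?S * pderiv (e - f) = 0"
        using ode f by (simp only: pderiv_diff right_diff_distrib algebra_simps)
      then show ?thesis by (simp only: minus_mult_left[symmetric] eq_neg_iff_add_eq_0 add.commute)
    qed
    show "poly (e - f) 0 = 0" using e0 by (simp add: f_def)
  qed simp
  then have ef: "e = ?S ^ k * ?D ^ r" by (simp add: f_def)
  \<comment> \<open>\<open>?S ^ Suc k * ?D ^ r\<close> solves the equation with right side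
    \<open>q (k+1) e\<close>. The homogeneous solution \<open>?D ^ n\<close> is subtracted to match
    \<open>a(0) = 0\<close>.\<close>
  define h where "h = smult (real q * real (Suc k)) a - (?S ^ Suc k * ?D ^ r - ?D ^ n)"
  have "h = 0"
  proof (rule poly_ode_unique)
    show "?D * pderiv h = [:- real n:] * h"
    proof (rule poly_ext)
      fix z
      have pS: "poly (pderiv (?S ^ Suc k)) z = real (Suc k) * (real q - 1) * poly (?S ^ k) z"
        by (simp add: pderiv_power_Suc pderiv_pCons del: power_Suc)
      have ez: "poly ?D z * poly (pderiv a) z = poly (?S ^ k) z * poly (?D ^ r) z - real n * poly a z"
        using arg_cong[OF ef, of "\<lambda>p. poly p z"] unfolding e poly_mult poly_add by simp
      have "poly (?D * pderiv h) z = real q * real (Suc k) * (poly ?D z * poly (pderiv a) z) -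
         (poly ?D z * poly (pderiv (?S ^ Suc k)) z * poly (?D ^ r) z +
          poly (?S ^ Suc k) z * (poly ?D z * poly (pderiv (?D ^ r)) z) -
          poly ?D z * poly (pderiv (?D ^ n)) z)"
        unfolding h_def pderiv_diff pderiv_smult pderiv_mult poly_mult poly_add poly_diff poly_smult
        by (simp only: algebra_simps)
      also have "\<dots> = real q * real (Suc k) * (poly (?S ^ k) z * poly (?D ^ r) z - real n * poly a z) -
         (poly ?D z * (real (Suc k) * (real q - 1) * poly (?S ^ k) z) * poly (?D ^ r) z +
          poly ?S z * poly (?S ^ k) z * (- real r * poly (?D ^ r) z) -
          (- real n * poly (?D ^ n) z))"
        unfolding ez pS Dr by (simp only: power_Suc poly_mult)
      also have "\<dots> = - real n * (real q * real (Suc k) * poly a z -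
          (poly ?S z * poly (?S ^ k) z * poly (?D ^ r) z - poly (?D ^ n) z)) +
          (real q * real (Suc k) - poly ?D z * (real (Suc k) * (real q - 1)) +
           real r * poly ?S z - real n * poly ?S z) * poly (?S ^ k) z * poly (?D ^ r) z"
        by algebra
      \<comment> \<open>Since \<open>n - r = k + 1\<close>, this is \<open>k + 1\<close> times
        \<open>q - (q-1)(1-z) - (1 + (q-1)z)\<close>, which is 0.\<close>
      also have "real q * real (Suc k) - poly ?D z * (real (Suc k) * (real q - 1)) +
           real r * poly ?S z - real n * poly ?S z = 0"
        by (simp add: nk algebra_simps)
      also have "- real n * (real q * real (Suc k) * poly a z -
          (poly ?S z * poly (?S ^ k) z * poly (?D ^ r) z - poly (?D ^ n) z)) +
          0 * poly (?S ^ k) z * poly (?D ^ r) z = poly ([:- real n:] * h) z"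
        unfolding h_def poly_mult poly_diff poly_smult power_Suc by simp
      finally show "poly (?D * pderiv h) z = poly ([:- real n:] * h) z" .
    qed
    show "poly h 0 = 0" using a0 poly_0_coeff_0[of a] by (simp add: h_def)
  qed simp
  then show ?thesis
    using that[of "Suc k" r] nk x by (simp add: h_def del: power_Suc of_nat_Suc)
qed

section \<open>Divisibility from the coefficient of \<open>t^n\<close>\<close>

theorem theorem1:
  fixes q n :: nat and C :: "word set"
  assumes "q \<ge> 2" and "n \<ge> 2"
    and "extended_one_perfect n q C"
  shows "\<exists>x::nat. real x = (real n + real q - 2) / real q \<and>
           (real q - 2) * (((real q - 1) ^ x - (-1) ^ x) / real x) \<in> \<nat>"
proof -
  note q = assms(1) and n = assms(2) and C = assms(3)
  have CW: "C \<subseteq> words n q" using C by (simp add: extended_one_perfect_def hamming_graph_def)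
  have fin: "finite C" using finite_subset[OF CW] by simp
  \<comment> \<open>A nonempty vertex set can only be covered by balls if there is a
    codeword.\<close>
  have "replicate (n - 1) 0 \<in> words (n - 1) q" using q by (auto simp: words_def)
  then have "C \<noteq> {}" using C n by (auto dest: spec[of _ 0] simp: extended_one_perfect_def one_perfect_def hamming_graph_def)
  then obtain c where c: "c \<in> C" by blast
  have cW: "c \<in> words n q" and [simp]: "length c = n" using c CW by (auto simp: words_def)
  \<comment> \<open>Some letter different from \<open>c ! i\<close>; 0 and 1 are both available as
    \<open>q \<ge> 2\<close>.\<close>
  define b where "b i = (if c ! i = 0 then 1 else 0 :: nat)" for i
  have b: "b i < q" "c ! i \<noteq> b i" for i using q by (auto simp: b_def)
  define u where "u = c[0 := b 0]"
  define v where "v = u[1 := b 1]"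
  have u: "u \<in> words n q" using words_update[OF cW b(1)] by (simp add: u_def)
  have v: "v \<in> words n q" using words_update[OF u b(1)] by (simp add: v_def)
  have [simp]: "length u = n" "length v = n" using u v by (auto simp: words_def)
  have cu: "hamming_dist c u = 1"
    using hamming_dist_update[of c c 0 "b 0"] b[of 0] n by (simp add: u_def)
  have cv: "hamming_dist c v = 2"
    using hamming_dist_update[of c u 1 "b 1"] b[of 1] n cu by (simp add: v_def u_def)
  \<comment> \<open>Other codewords are at distance at least 4 from \<open>c\<close>. Hence
    \<open>c\<close> is the only codeword within distance 1 of \<open>u\<close>, and none lies that
    close to \<open>v\<close>, which fixes the first two coefficients of \<open>a\<close>.\<close>
  have far: "hamming_dist u c' \<ge> 3" "hamming_dist v c' \<ge> 2" if "c' \<in> C" "c' \<noteq> c" for c'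
  proof -
    have [simp]: "length c' = n" using that CW by (auto simp: words_def)
    have "hamming_dist c c' \<ge> 4" using extended_one_perfect_dist[OF n C, of c c'] that c by simp
    then show "hamming_dist u c' \<ge> 3" "hamming_dist v c' \<ge> 2"
      using hamming_dist_triangle[of c u c'] hamming_dist_triangle[of c v c'] cu cv by simp_all
  qed
  have uc: "hamming_dist u c = 1" and vc: "hamming_dist v c = 2"
    using cu cv hamming_dist_commute[of c u] hamming_dist_commute[of c v] by simp_all
  define a where "a = distance_enum C u - distance_enum C v"
  have u0: "{p \<in> C. hamming_dist u p = 0} = {}" and v0: "{p \<in> C. hamming_dist v p = 0} = {}"
    and u1: "{p \<in> C. hamming_dist u p = 1} = {c}" and v1: "{p \<in> C. hamming_dist v p = 1} = {}"
    using far uc vc c by fastforce+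
  have a0: "coeff a 0 = 0" and a1: "coeff a 1 = 1"
    unfolding a_def coeff_diff coeff_distance_enum[OF fin] u0 v0 u1 v1 by simp_all
  define e where "e = [:real n:] * a + [:1, -1:] * pderiv a"
  define E where "E w = [:real n:] * distance_enum C w + [:1, -1:] * pderiv (distance_enum C w)" for w
  have eE: "e = E u - E v" unfolding e_def a_def E_def pderiv_diff by (simp only: algebra_simps)
  have "[:1, (real q - 1) * (real n - 1):] * e + [:1, -1:] * [:1, real q - 1:] * pderiv e =
     ([:1, (real q - 1) * (real n - 1):] * E u + [:1, -1:] * [:1, real q - 1:] * pderiv (E u)) -
     ([:1, (real q - 1) * (real n - 1):] * E v + [:1, -1:] * [:1, real q - 1:] * pderiv (E v))"
    unfolding eE pderiv_diff by (simp only: algebra_simps)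
  also have "\<dots> = 0"
    using distance_enum_extended_one_perfect[OF n C u E_def]
      distance_enum_extended_one_perfect[OF n C v E_def] by simp
  finally have ode: "[:1, (real q - 1) * (real n - 1):] * e +
    [:1, -1:] * [:1, real q - 1:] * pderiv e = 0" .
  obtain x r where x: "x \<ge> 1" "n = x + r" "real q * real x = real n + real q - 2"
    and a: "smult (real q * real x) a = [:1, real q - 1:] ^ x * [:1, -1:] ^ r - [:1, -1:] ^ n"
    using distance_enum_difference[OF q n e_def ode a0 a1] .
  obtain k :: int where k: "coeff a n = of_int k"
  proof
    show "coeff a n = of_int (int (card {p \<in> C. hamming_dist u p = n}) -
        int (card {p \<in> C. hamming_dist v p = n}))"
      unfolding a_def coeff_diff coeff_distance_enum[OF fin] by simp
  qed
  \<comment> \<open>As \<open>q - 1\<close> is nonzero the degrees are exact and add up to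
    \<open>n\<close>, so the coefficient at \<open>n\<close> is the product of the leading
    coefficients.\<close>
  have deg: "degree ([:1, real q - 1:] ^ x) = x" "degree ([:1, -1:] ^ r :: real poly) = r"
    using q by (simp_all add: degree_power_eq)
  have "coeff ([:1, real q - 1:] ^ x * [:1, -1:] ^ r) n = (real q - 1) ^ x * (-1) ^ r"
    using coeff_mult_degree_sum[of "[:1, real q - 1:] ^ x" "[:1, -1:] ^ r"]
      lead_coeff_power[of "[:1, real q - 1:]" x] q
    unfolding deg x(2) by simp
  then have "real q * real x * of_int k = (real q - 1) ^ x * (-1) ^ r - (-1) ^ n"
    using arg_cong[OF a, of "\<lambda>p. coeff p n"] by (simp add: k)
  also have "\<dots> = (-1) ^ r * ((real q - 1) ^ x - (-1) ^ x)"
    unfolding x(2) power_add by (simp only: algebra_simps)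
  finally have "(-1) ^ r * (real q * real x * of_int k) = (real q - 1) ^ x - (-1) ^ x"
    by (simp flip: mult.assoc power_mult_distrib)
  then have "((real q - 1) ^ x - (-1) ^ x) / real x = of_int ((-1) ^ r * int q * k)"
    using x(1) by (simp add: field_simps)
  then have eq: "(real q - 2) * (((real q - 1) ^ x - (-1) ^ x) / real x) =
      of_int ((int q - 2) * ((-1) ^ r * int q * k))"
    by simp
  \<comment> \<open>The number is already known to be an integer; nonnegativity makes it a natural
    number.\<close>
  have "(-1) ^ x \<le> (1 :: real)" by (cases "even x") auto
  also have "1 \<le> (real q - 1) ^ x" using q by (intro one_le_power) simp
  finally have "0 \<le> (real q - 2) * (((real q - 1) ^ x - (-1) ^ x) / real x)" using q by simp
  then have "(real q - 2) * (((real q - 1) ^ x - (-1) ^ x) / real x) \<in> \<nat>"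
    unfolding eq Nats_altdef2 by auto
  moreover have "real x = (real n + real q - 2) / real q" using x(3) q by (simp add: field_simps)
  ultimately show ?thesis by blast
qed

end
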